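(* Let $S$ be a nonempty closed set in a Banach space $X$. Assume that for every $x^*\in X^*$ the problem $$\text{minimize } \tfrac12\|x\|^2-\langle x,x^*\rangle\ \text{ for } x\in S$$ is Tykhonov well posed. Then $S$ is convex. If $X$ is an E-space, the converse holds: if $S$ is convex, then this problem is Tykhonov well posed for every $x^*\in X^*$.
   Context: $X$ is a (real) Banach space with norm $\|\cdot\|$ and topological dual $X^*$; $\langle x,x^*\rangle:=x^*(x)$. The problem of minimizing a function $I$ over $S$ is Tykhonov well posed (TWP) if $I$ attains a strong minimum over $S$: there is a minimum point $\bar x\in S$ of $I$ over $S$, and every sequence $(x_n)$ in $S$ with $I(x_n)\to\inf_S I$ converges in norm to $\bar x$. A Banach space $X$ is an E-space if $X$ is rotund (strictly convex norm) and every (nonempty) weakly closed set in $X$ is approximately compact. A nonempty set $A\subset X$ is approximately compact if for every $x\in X$, every sequence $(a_n)$ in $A$ with $\|x-a_n\|\to\inf_{a\in A}\|x-a\|$ has a subsequence converging in norm to a point of $A$. *)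

theory Defs
  imports "HOL-Analysis.Analysis"
begin

(* The first two conjuncts force I to be bounded below on a nonempty S, so the real-valued
   infimum below is the true one. *)
definition tykhonov_well_posed :: "('a::real_normed_vector \<Rightarrow> real) \<Rightarrow> 'a set \<Rightarrow> bool" where
  "tykhonov_well_posed I S \<longleftrightarrow>
     (\<exists>xbar\<in>S. (\<forall>x\<in>S. I xbar \<le> I x) \<and>
       (\<forall>u :: nat \<Rightarrow> 'a. (\<forall>n. u n \<in> S) \<longrightarrow> (\<lambda>n. I (u n)) \<longlonglongrightarrow> (INF x\<in>S. I x)
          \<longrightarrow> u \<longlonglongrightarrow> xbar))"

text \<open>The initial topology with respect to the topological dual, i.e. to all continuous
  linear functionals.\<close>
definition weak_topology :: "'a::real_normed_vector topology" where
  "weak_topology =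
     topology_generated_by {blinfun_apply f -` U | (f :: 'a \<Rightarrow>\<^sub>L real) U. open U}"

lemma topspace_weak_topology: "topspace (weak_topology :: 'a::real_normed_vector topology) = UNIV"
proof -
  have "UNIV = blinfun_apply (0 :: 'a \<Rightarrow>\<^sub>L real) -` UNIV" by simp
  then have "UNIV \<in> {blinfun_apply f -` U | (f :: 'a \<Rightarrow>\<^sub>L real) U. open U}"
    using open_UNIV by blast
  then show ?thesis
    unfolding weak_topology_def topology_generated_by_topspace by blast
qed

definition approximately_compact :: "'a::real_normed_vector set \<Rightarrow> bool" where
  "approximately_compact A \<longleftrightarrow>
     (\<forall>x. \<forall>a :: nat \<Rightarrow> 'a. (\<forall>n. a n \<in> A) \<longrightarrow>
        (\<lambda>n. norm (x - a n)) \<longlonglongrightarrow> (INF y\<in>A. norm (x - y)) \<longrightarrow>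
        (\<exists>r l. strict_mono r \<and> l \<in> A \<and> (a \<circ> r) \<longlonglongrightarrow> l))"

definition rotund :: "'a::real_normed_vector itself \<Rightarrow> bool" where
  "rotund _ \<longleftrightarrow>
     (\<forall>x y :: 'a. norm x = 1 \<longrightarrow> norm y = 1 \<longrightarrow> x \<noteq> y \<longrightarrow> norm ((1/2) *\<^sub>R (x + y)) < 1)"

definition E_space :: "'a::banach itself \<Rightarrow> bool" where
  "E_space _ \<longleftrightarrow> rotund TYPE('a) \<and>
     (\<forall>A :: 'a set. A \<noteq> {} \<longrightarrow> closedin weak_topology A \<longrightarrow> approximately_compact A)"

end

theory Submission
  imports Defs
begin

text \<open>
  Well-posedness implies convexity. Write \<open>I\<close> for half the squared norm and let \<open>F y\<close> be the supremum
  of \<open>y s - I s\<close> over \<open>s \<in> S\<close>, the Fenchel conjugate of \<open>I\<close> restricted to \<open>S\<close>. Well-posedness says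
  that the supremum is attained at a point \<open>M y \<in> S\<close> to which all maximizing sequences converge, so
  that \<open>M y\<close> is the derivative of \<open>F\<close> at \<open>y\<close>. If \<open>x\<close> is a convex combination of points of \<open>S\<close>, then
  \<open>F y - y x\<close> is bounded below in \<open>y\<close>. Ekeland's variational principle in the dual space, which is
  complete, gives an almost critical point \<open>y\<close>, where the derivative \<open>M y - x\<close> of \<open>F y - y x\<close> has norm
  at most \<open>\<epsilon>\<close>. Hence \<open>x\<close> is a limit of points of \<open>S\<close>, and so lies in \<open>S\<close>. The argument works for every
  function \<open>I\<close> (\<open>convex_if_linear_perturbations_well_posed\<close>).

  Convexity implies well-posedness in an E-space. Rotundity makes the minimizer unique, so it
  suffices that each minimizing sequence has a convergent subsequence. Pass to a subsequence \<open>u\<close>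
  along which the norms converge, to \<open>r\<close> say. If \<open>r = 0\<close>, then \<open>u\<close> tends to \<open>0\<close>. If \<open>r > 0\<close>, the first
  order condition at the minimum, followed by the Mazur--Orlicz theorem, yields a functional \<open>z\<close>
  with \<open>z v \<le> r * norm v\<close> everywhere and with \<open>z (u n)\<close> tending to \<open>r\<^sup>2\<close>. After rescaling into the
  hyperplane where \<open>z = r\<^sup>2\<close>, the sequence minimizes the distance from \<open>0\<close> to that hyperplane, and the
  hyperplane is weakly closed, hence approximately compact. So the E-space hypothesis is applied to
  a hyperplane and not to \<open>S\<close> itself, and reflexivity of the space never has to be established.
\<close>

section \<open>Sublinear functionals and the Mazur--Orlicz theorem\<close>

definition sublinear :: "('a::real_vector \<Rightarrow> real) \<Rightarrow> bool" where
  "sublinear p \<longleftrightarrow>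
     (\<forall>x y. p (x + y) \<le> p x + p y) \<and> (\<forall>t x. 0 \<le> t \<longrightarrow> p (t *\<^sub>R x) \<le> t * p x)"

lemma sublinear_add: "sublinear p \<Longrightarrow> p (x + y) \<le> p x + p y"
  and sublinear_scale_le: "sublinear p \<Longrightarrow> 0 \<le> t \<Longrightarrow> p (t *\<^sub>R x) \<le> t * p x"
  by (auto simp: sublinear_def)

lemma sublinear_0: 
  assumes "sublinear p" shows "p 0 = 0"
  using sublinear_add[OF assms, of 0 0] sublinear_scale_le[OF assms, of 0 0] by simp

lemma sublinear_scale: 
  assumes p: "sublinear p" and "0 \<le> t" 
  shows "p (t *\<^sub>R x) = t * p x"
proof (cases "t = 0")
  case False
  then have t: "0 < t" using assms by simp
  have "p x = p ((1/t) *\<^sub>R (t *\<^sub>R x))" using t by simp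
  also have "\<dots> \<le> (1/t) * p (t *\<^sub>R x)" using t by (intro sublinear_scale_le[OF p]) simp
  finally have "t * p x \<le> p (t *\<^sub>R x)" using t by (simp add: field_simps)
  then show ?thesis using sublinear_scale_le[OF p \<open>0 \<le> t\<close>, of x] by simp
qed (simp add: sublinear_0[OF p])

lemma sublinear_neg_le:
  assumes "sublinear p" shows "- p (- x) \<le> p x"
  using sublinear_add[OF assms, of x "- x"] sublinear_0[OF assms] by simp

text \<open>Both sublinear functionals constructed below are pointwise infima: that of a chain, in the search
  for a minimal functional, and that of a family of translates, in \<open>sublinear_lowering\<close>.\<close>

lemma sublinear_Inf:
  fixes V :: "'a::real_vector \<Rightarrow> real set"
  assumes ne: "\<And>x. V x \<noteq> {}" and bdd: "\<And>x. bdd_below (V x)"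
    and add: "\<And>x y a b. a \<in> V x \<Longrightarrow> b \<in> V y \<Longrightarrow> \<exists>c\<in>V (x + y). c \<le> a + b"
    and scale: "\<And>t x a. a \<in> V x \<Longrightarrow> 0 \<le> t \<Longrightarrow> \<exists>c\<in>V (t *\<^sub>R x). c \<le> t * a"
  shows "sublinear (\<lambda>x. Inf (V x))"
  unfolding sublinear_def
proof (intro conjI allI impI)
  fix x y
  have "Inf (V (x + y)) \<le> a + b" if "a \<in> V x" "b \<in> V y" for a b
    using add[OF that] cInf_lower[OF _ bdd] by (meson order_trans)
  then have "Inf (V (x + y)) - b \<le> Inf (V x)" if "b \<in> V y" for b
    using that by (intro cInf_greatest[OF ne]) (simp add: algebra_simps)
  then have "Inf (V (x + y)) - Inf (V x) \<le> Inf (V y)"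
    by (intro cInf_greatest[OF ne]) (simp add: algebra_simps)
  then show "Inf (V (x + y)) \<le> Inf (V x) + Inf (V y)" by simp
next
  fix t :: real and x assume t: "0 \<le> t"
  have le: "Inf (V (t *\<^sub>R x)) \<le> t * a" if "a \<in> V x" for a
    using scale[OF that t] cInf_lower[OF _ bdd] by (meson order_trans)
  show "Inf (V (t *\<^sub>R x)) \<le> t * Inf (V x)"
  proof (cases "t = 0")
    case True
    then show ?thesis using le ne[of x] by auto
  next
    case False
    then have "Inf (V (t *\<^sub>R x)) / t \<le> Inf (V x)"
      using t le by (intro cInf_greatest[OF ne]) (simp add: field_simps)
    then show ?thesis using t False by (simp add: field_simps)
  qed
qed

text \<open>The infimum of \<open>p (x + t *\<^sub>R c) - t * d c\<close> over \<open>t \<ge> 0\<close> and \<open>c \<in> C\<close> is the largest sublinear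
  functional below \<open>p\<close> with value at most \<open>- d c\<close> at \<open>- c\<close>. It is finite because \<open>d \<le> p\<close> on \<open>C\<close>, and
  subadditive because \<open>d\<close> is concave. A linear functional \<open>h\<close> below it satisfies
  \<open>h c = - h (- c) \<ge> d c\<close>, which is how lower bounds on \<open>C\<close> are enforced.\<close>

lemma sublinear_lowering:
  fixes p :: "'a::real_vector \<Rightarrow> real"
  assumes p: "sublinear p" and C: "C \<noteq> {}" and d: "concave_on C d"
    and le: "\<And>c. c \<in> C \<Longrightarrow> d c \<le> p c"
  obtains q where "sublinear q" "\<And>x. q x \<le> p x" "\<And>c. c \<in> C \<Longrightarrow> q (- c) \<le> - d c"
proof -
  define V where "V x = {p (x + t *\<^sub>R c) - t * d c | t c. 0 \<le> t \<and> c \<in> C}" for x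
  have VI: "p (x + t *\<^sub>R c) - t * d c \<in> V x" if "0 \<le> t" "c \<in> C" for x t c
    using that unfolding V_def by blast
  obtain c0 where c0: "c0 \<in> C" using C by blast
  have p_in: "p x \<in> V x" for x using VI[of 0 c0 x] c0 by simp
  have bdd: "bdd_below (V x)" for x
  proof (rule bdd_belowI)
    fix a assume "a \<in> V x"
    then obtain t c where tc: "0 \<le> t" "c \<in> C" "a = p (x + t *\<^sub>R c) - t * d c"
      unfolding V_def by blast
    have "t * d c \<le> t * p c" using tc le by (intro mult_left_mono) auto
    also have "\<dots> = p ((x + t *\<^sub>R c) + - x)" using sublinear_scale[OF p tc(1)] by simp
    also have "\<dots> \<le> p (x + t *\<^sub>R c) + p (- x)" by (rule sublinear_add[OF p])
    finally show "- p (- x) \<le> a" using tc by simp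
  qed
  have "sublinear (\<lambda>x. Inf (V x))"
  proof (rule sublinear_Inf)
    show "V x \<noteq> {}" for x using p_in by blast
    show "bdd_below (V x)" for x by (rule bdd)
    show "\<exists>c\<in>V (x + y). c \<le> a + b" if ab: "a \<in> V x" "b \<in> V y" for x y a b
    proof -
      obtain t c where tc: "0 \<le> t" "c \<in> C" "a = p (x + t *\<^sub>R c) - t * d c"
        using ab unfolding V_def by blast
      obtain s e where se: "0 \<le> s" "e \<in> C" "b = p (y + s *\<^sub>R e) - s * d e"
        using ab unfolding V_def by blast
      show ?thesis
      proof (cases "t + s = 0")
        case True
        then have "t = 0" "s = 0" using tc se by auto
        then show ?thesis using tc se sublinear_add[OF p, of x y] p_in by auto
      next
        case False
        then have ts: "0 < t + s" using tc se by auto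
        \<comment> \<open>two terms of the infimum merge into the one at their weighted mean\<close>
        define g where "g = (t/(t+s)) *\<^sub>R c + (s/(t+s)) *\<^sub>R e"
        have uv: "0 \<le> t/(t+s)" "0 \<le> s/(t+s)" "t/(t+s) + s/(t+s) = 1"
          using tc se ts by (auto simp flip: add_divide_distrib)
        have "convex C" using d by (simp add: concave_on_iff)
        then have g: "g \<in> C" unfolding g_def using tc se uv by (intro convexD)
        have dg: "(t/(t+s)) * d c + (s/(t+s)) * d e \<le> d g"
          using d tc(2) se(2) uv unfolding g_def concave_on_iff by blast
        have "(t+s) * ((t/(t+s)) * d c + (s/(t+s)) * d e) \<le> (t+s) * d g"
          using dg ts by (intro mult_left_mono) auto
        then have dg': "t * d c + s * d e \<le> (t+s) * d g"
          using ts by (simp add: distrib_left)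
        have "(t+s) *\<^sub>R g = t *\<^sub>R c + s *\<^sub>R e"
          using ts unfolding g_def by (simp add: scaleR_add_right)
        then have "(x + y) + (t+s) *\<^sub>R g = (x + t *\<^sub>R c) + (y + s *\<^sub>R e)" by simp
        then have "p ((x + y) + (t+s) *\<^sub>R g) \<le> p (x + t *\<^sub>R c) + p (y + s *\<^sub>R e)"
          using sublinear_add[OF p] by metis
        then show ?thesis
          using VI[of "t+s" g "x+y"] ts g dg' tc se by (intro bexI) auto
      qed
    qed
    show "\<exists>c\<in>V (t *\<^sub>R x). c \<le> t * a" if a: "a \<in> V x" and t: "0 \<le> t" for t x a
    proof -
      obtain s c where sc: "0 \<le> s" "c \<in> C" "a = p (x + s *\<^sub>R c) - s * d c"
        using a unfolding V_def by blast
      have "p (t *\<^sub>R x + (t * s) *\<^sub>R c) = t * p (x + s *\<^sub>R c)"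
        using sublinear_scale[OF p t, of "x + s *\<^sub>R c"] by (simp add: scaleR_add_right)
      then have "p (t *\<^sub>R x + (t * s) *\<^sub>R c) - (t * s) * d c = t * a"
        using sc by (simp add: right_diff_distrib mult.assoc)
      then show ?thesis using VI[of "t * s" c "t *\<^sub>R x"] sc t by force
    qed
  qed
  moreover have "Inf (V x) \<le> p x" for x by (rule cInf_lower[OF p_in bdd])
  moreover have "Inf (V (- c)) \<le> - d c" if "c \<in> C" for c
    using cInf_lower[OF VI[of 1 c "- c"] bdd] that sublinear_0[OF p] by simp
  ultimately show ?thesis by (rule that)
qed

text \<open>Zorn's lemma applies since the values at \<open>x\<close> of functionals below \<open>p\<close> are bounded below by
  \<open>- p (- x)\<close>.\<close>

lemma minimal_sublinear_exists:
  fixes p :: "'a::real_vector \<Rightarrow> real"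
  assumes p: "sublinear p"
  obtains h where "sublinear h" "h \<le> p" "\<And>q. sublinear q \<Longrightarrow> q \<le> h \<Longrightarrow> q = h"
proof -
  define A where "A = {q. sublinear q \<and> q \<le> p}"
  have "\<exists>m\<in>A. \<forall>a\<in>A. m \<ge> a \<longrightarrow> a = m"
  proof (rule predicate_Zorn)
    show "partial_order_on A (relation_of (\<ge>) A)"
      by (rule partial_order_on_relation_ofI) auto
  next
    fix C assume chain: "C \<in> Chains (relation_of (\<ge>) A)"
    then have CA: "C \<subseteq> A" by (rule Chains_relation_of)
    have lin: "q \<le> r \<or> r \<le> q" if "q \<in> C" "r \<in> C" for q r
      using chain that unfolding Chains_def relation_of_def by auto
    show "\<exists>u\<in>A. \<forall>a\<in>C. a \<ge> u"
    proof (cases "C = {}")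
      case True
      then show ?thesis using p by (auto simp: A_def)
    next
      case False
      define V where "V x = (\<lambda>q. q x) ` C" for x
      have bdd: "bdd_below (V x)" for x
      proof (rule bdd_belowI)
        fix a assume "a \<in> V x"
        then obtain q where q: "q \<in> C" "a = q x" by (auto simp: V_def)
        then have "sublinear q" "q (- x) \<le> p (- x)" using CA by (auto simp: A_def le_fun_def)
        then show "- p (- x) \<le> a" using sublinear_neg_le[of q x] q by simp
      qed
      have low: "Inf (V x) \<le> q x" if "q \<in> C" for q x
        using that by (intro cInf_lower[OF _ bdd]) (auto simp: V_def)
      have "sublinear (\<lambda>x. Inf (V x))"
      proof (rule sublinear_Inf)
        show "V x \<noteq> {}" for x using False by (simp add: V_def)
        show "bdd_below (V x)" for x by (rule bdd)
        show "\<exists>c\<in>V (x + y). c \<le> a + b" if ab: "a \<in> V x" "b \<in> V y" for x y a b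
        proof -
          obtain q r where qr: "q \<in> C" "a = q x" "r \<in> C" "b = r y"
            using ab by (auto simp: V_def)
          \<comment> \<open>the smaller of the two chain members serves both arguments\<close>
          obtain s where s: "s \<in> C" "s \<le> q" "s \<le> r"
            using lin[OF qr(1,3)] qr by blast
          have "s (x + y) \<le> s x + s y" using s CA by (auto simp: A_def intro: sublinear_add)
          also have "\<dots> \<le> a + b" using s qr by (auto simp: le_fun_def intro: add_mono)
          finally show ?thesis using s by (auto simp: V_def)
        qed
        show "\<exists>c\<in>V (t *\<^sub>R x). c \<le> t * a" if "a \<in> V x" "0 \<le> t" for t x a
          using that CA by (auto simp: V_def A_def intro!: sublinear_scale_le)
      qed
      moreover have "(\<lambda>x. Inf (V x)) \<le> p"
      proof -
        obtain q where "q \<in> C" using False by blast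
        then have "q \<le> p" using CA by (auto simp: A_def)
        then show ?thesis using low[OF \<open>q \<in> C\<close>] by (auto simp: le_fun_def intro: order_trans)
      qed
      ultimately show ?thesis
        using low by (intro bexI[of _ "\<lambda>x. Inf (V x)"]) (auto simp: A_def le_fun_def)
    qed
  qed
  then obtain m where "m \<in> A" "\<And>a. a \<in> A \<Longrightarrow> a \<le> m \<Longrightarrow> a = m" by blast
  then show ?thesis by (intro that[of m]) (auto simp: A_def)
qed

text \<open>Lowering \<open>h\<close> with \<open>C = {y}\<close> and the bound \<open>h y\<close> cannot change a minimal \<open>h\<close>, which forces
  \<open>h (- y) \<le> - h y\<close>. A sublinear functional that is odd is linear.\<close>

lemma minimal_sublinear_linear:
  fixes h :: "'a::real_vector \<Rightarrow> real"
  assumes h: "sublinear h" and min: "\<And>q. sublinear q \<Longrightarrow> q \<le> h \<Longrightarrow> q = h"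
  shows "linear h"
proof -
  have neg: "h (- y) = - h y" for y
  proof -
    obtain q where q: "sublinear q" "\<And>x. q x \<le> h x" "\<And>c. c \<in> {y} \<Longrightarrow> q (- c) \<le> - h y"
      by (rule sublinear_lowering[OF h, of "{y}" "\<lambda>_. h y"]) (auto simp: concave_on_const)
    then have "q = h" by (intro min) (auto simp: le_fun_def)
    then show ?thesis using q(3)[of y] sublinear_neg_le[OF h, of "y"] by simp
  qed
  have scale: "h (t *\<^sub>R x) = t * h x" for t x
  proof (cases "0 \<le> t")
    case True
    then show ?thesis by (rule sublinear_scale[OF h])
  next
    case False
    then show ?thesis using sublinear_scale[OF h, of "- t" x] neg[of "t *\<^sub>R x"] by simp
  qed
  have "h (x + y) = h x + h y" for x y
  proof (rule antisym)
    have "h x = h ((x + y) + - y)" by simp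
    also have "\<dots> \<le> h (x + y) - h y" using sublinear_add[OF h, of "x + y" "- y"] neg by simp
    finally show "h x + h y \<le> h (x + y)" by simp
  qed (rule sublinear_add[OF h])
  with scale show ?thesis by (intro linearI) auto
qed

text \<open>A sandwich form of the Hahn--Banach theorem. A singleton \<open>C\<close> yields norming functionals, and an
  affine \<open>d\<close> on a convex set yields Lagrange multipliers; both are used below.\<close>

theorem mazur_orlicz:
  fixes p :: "'a::real_vector \<Rightarrow> real"
  assumes p: "sublinear p" and C: "C \<noteq> {}" and d: "concave_on C d"
    and le: "\<And>c. c \<in> C \<Longrightarrow> d c \<le> p c"
  obtains h where "linear h" "\<And>x. h x \<le> p x" "\<And>c. c \<in> C \<Longrightarrow> d c \<le> h c"
proof -
  obtain q where q: "sublinear q" "\<And>x. q x \<le> p x" "\<And>c. c \<in> C \<Longrightarrow> q (- c) \<le> - d c"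
    using sublinear_lowering[OF assms] by blast
  obtain h where h: "sublinear h" "h \<le> q" "\<And>r. sublinear r \<Longrightarrow> r \<le> h \<Longrightarrow> r = h"
    using minimal_sublinear_exists[OF q(1)] by blast
  have lin: "linear h" by (rule minimal_sublinear_linear[OF h(1,3)])
  show ?thesis
  proof (rule that[OF lin])
    show "h x \<le> p x" for x using h(2) q(2)[of x] by (meson le_funD order_trans)
    show "d c \<le> h c" if "c \<in> C" for c
      using q(3)[OF that] h(2) linear_neg[OF lin, of c] le_funD[OF h(2), of "- c"] by simp
  qed
qed

corollary mazur_orlicz_norm:
  fixes d :: "'a::real_normed_vector \<Rightarrow> real"
  assumes r: "0 \<le> r" and C: "C \<noteq> {}" and d: "concave_on C d"
    and le: "\<And>c. c \<in> C \<Longrightarrow> d c \<le> r * norm c"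
  obtains h :: "'a \<Rightarrow>\<^sub>L real"
  where "\<And>x. \<bar>h x\<bar> \<le> r * norm x" "\<And>c. c \<in> C \<Longrightarrow> d c \<le> h c"
proof -
  have "r * norm (x + y) \<le> r * norm x + r * norm y" for x y :: 'a
    using r mult_left_mono[OF norm_triangle_ineq[of x y], of r] by (simp add: distrib_left)
  then have "sublinear (\<lambda>x::'a. r * norm x)" unfolding sublinear_def by simp
  then obtain g where g: "linear g" "\<And>x. g x \<le> r * norm x" "\<And>c. c \<in> C \<Longrightarrow> d c \<le> g c"
    using mazur_orlicz[OF _ C d le] by metis
  have bd: "\<bar>g x\<bar> \<le> r * norm x" for x
    using g(2)[of x] g(2)[of "- x"] linear_neg[OF g(1), of x] by (simp add: abs_le_iff)
  have "bounded_linear g"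
    using g(1) bd by (intro bounded_linear_intro[where K = r])
      (auto simp: linear_add linear_cmul mult.commute)
  then have "blinfun_apply (Blinfun g) = g" by (rule bounded_linear_Blinfun_apply)
  then show ?thesis using bd g(3) by (intro that[of "Blinfun g"]) auto
qed

section \<open>Ekeland's variational principle\<close>

text \<open>The sets \<open>A x\<close> are the lower sections of a partial order. Descending in it, almost as far as
  possible in each step, gives a Cauchy sequence because the distances are controlled by the decrease
  of \<open>g\<close>; nothing lies strictly below its limit. Lower semicontinuity of \<open>g\<close> is expressed by closed
  sublevel sets.\<close>

theorem ekeland_variational_principle:
  fixes g :: "'b::complete_space \<Rightarrow> real"
  assumes eps: "0 < \<epsilon>" and bdd: "\<And>y. b \<le> g y" and lsc: "\<And>c. closed {y. g y \<le> c}"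
  obtains y where "\<And>z. z \<noteq> y \<Longrightarrow> g y < g z + \<epsilon> * dist y z"
proof -
  define A where "A x = {y. g y + \<epsilon> * dist x y \<le> g x}" for x
  have self: "x \<in> A x" for x by (simp add: A_def)
  have trans: "z \<in> A x" if "y \<in> A x" "z \<in> A y" for x y z
  proof -
    have "\<epsilon> * dist x z \<le> \<epsilon> * dist x y + \<epsilon> * dist y z"
      using eps mult_left_mono[OF dist_triangle, of \<epsilon> x z y] by (simp add: distrib_left)
    then show ?thesis using that by (simp add: A_def)
  qed
  have bddA: "bdd_below (g ` A x)" for x by (rule bdd_belowI2[of _ b]) (rule bdd)
  have step: "\<exists>y\<in>A x. g y < Inf (g ` A x) + 1 / 2 ^ n" for x and n :: nat
    using cInf_lessD[of "g ` A x" "Inf (g ` A x) + 1 / 2 ^ n"] self by auto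
  define nxt where
    "nxt n x = (SOME y. y \<in> A x \<and> g y < Inf (g ` A x) + 1 / 2 ^ n)" for n :: nat and x
  have nxt: "nxt n x \<in> A x" "g (nxt n x) < Inf (g ` A x) + 1 / 2 ^ n" for n x
    using someI_ex[of "\<lambda>y. y \<in> A x \<and> g y < Inf (g ` A x) + 1 / 2 ^ n"] step[of x n]
    unfolding nxt_def by blast+
  obtain x0 :: 'b where True by blast
  define X where "X = rec_nat x0 nxt"
  have X: "X (Suc n) = nxt n (X n)" for n by (simp add: X_def)
  have mem: "X m \<in> A (X n)" if "n \<le> m" for n m
    using that by (induction m rule: dec_induct) (auto simp: X self intro: trans nxt)
  have dist_le: "\<epsilon> * dist (X n) (X m) \<le> g (X n) - g (X m)" if "n \<le> m" for n m
    using mem[OF that] by (simp add: A_def)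
  have dec: "g (X m) \<le> g (X n)" if "n \<le> m" for n m
    using dist_le[OF that] eps by (smt (verit) mult_nonneg_nonneg zero_le_dist)
  have "decseq (\<lambda>n. g (X n))" using dec by (simp add: decseq_def)
  then obtain L where "(\<lambda>n. g (X n)) \<longlonglongrightarrow> L"
    using decseq_convergent[of "\<lambda>n. g (X n)" b] bdd by metis
  then have "Cauchy (\<lambda>n. g (X n))" by (rule LIMSEQ_imp_Cauchy)
  have "Cauchy X"
  proof (rule CauchyI')
    fix e :: real assume "0 < e"
    then obtain M where M: "\<And>m n. M \<le> m \<Longrightarrow> M \<le> n \<Longrightarrow> \<bar>g (X m) - g (X n)\<bar> < \<epsilon> * e"
      using \<open>Cauchy (\<lambda>n. g (X n))\<close> eps unfolding Cauchy_def dist_real_def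
      by (meson mult_pos_pos)
    have "dist (X m) (X n) < e" if "M \<le> m" "m < n" for m n
    proof -
      have "\<epsilon> * dist (X m) (X n) < \<epsilon> * e"
        using dist_le[of m n] M[of m n] that by simp
      then show ?thesis using eps by simp
    qed
    then show "\<exists>M. \<forall>m\<ge>M. \<forall>n>m. dist (X m) (X n) < e" by blast
  qed
  then obtain y where y: "X \<longlonglongrightarrow> y" using Cauchy_convergent convergentD by blast
  have yA: "y \<in> A (X n)" for n
  proof -
    have "g y \<le> g (X n) - \<epsilon> * dist (X n) y + \<delta>" if "0 < \<delta>" for \<delta>
    proof -
      have "(\<lambda>m. g (X n) - \<epsilon> * dist (X n) (X m)) \<longlonglongrightarrow> g (X n) - \<epsilon> * dist (X n) y"
        by (intro tendsto_intros y)
      then have "\<forall>\<^sub>F m in sequentially.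
          g (X n) - \<epsilon> * dist (X n) (X m) < g (X n) - \<epsilon> * dist (X n) y + \<delta>"
        by (rule order_tendstoD) (use that in simp)
      then have "\<forall>\<^sub>F m in sequentially. X m \<in> {z. g z \<le> g (X n) - \<epsilon> * dist (X n) y + \<delta>}"
        using eventually_ge_at_top[of n]
      proof eventually_elim
        case (elim m)
        then show ?case using dist_le[of n m] by simp
      qed
      then have "y \<in> {z. g z \<le> g (X n) - \<epsilon> * dist (X n) y + \<delta>}"
        using Lim_in_closed_set[OF lsc] y by (metis trivial_limit_sequentially)
      then show ?thesis by simp
    qed
    then have "g y \<le> g (X n) - \<epsilon> * dist (X n) y" by (rule field_le_epsilon)
    then show ?thesis by (simp add: A_def)
  qed
  show ?thesis
  proof (rule that, rule ccontr)
    fix z assume z: "z \<noteq> y" "\<not> g y < g z + \<epsilon> * dist y z"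
    then have "z \<in> A y" by (simp add: A_def)
    have "g y - g z \<le> 1 / 2 ^ n" for n :: nat
    proof -
      have "g (X (Suc n)) < g z + 1 / 2 ^ n"
        using nxt(2)[of n "X n"] cInf_lower[OF _ bddA, of "g z" "X n"] trans[OF yA \<open>z \<in> A y\<close>]
        unfolding X by force
      moreover have "g y \<le> g (X (Suc n))"
        using yA[of "Suc n"] eps unfolding A_def
        by (smt (verit) mem_Collect_eq mult_nonneg_nonneg zero_le_dist)
      ultimately show ?thesis by simp
    qed
    moreover have "(\<lambda>n. 1 / 2 ^ n :: real) \<longlonglongrightarrow> 0" by real_asymp
    ultimately have "g y - g z \<le> 0" by (intro LIMSEQ_le_const) auto
    moreover have "0 < \<epsilon> * dist y z" using z eps by simp
    ultimately show False using z by simp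
  qed
qed


section \<open>Well-posedness forces convexity\<close>

text \<open>Since the infimum is attained, minimizing sequences can be described by the minimum value, which
  is easier to squeeze than an infimum.\<close>

lemma tykhonov_well_posed_iff_min_value:
  "tykhonov_well_posed I S \<longleftrightarrow>
     (\<exists>m\<in>S. (\<forall>x\<in>S. I m \<le> I x) \<and>
        (\<forall>u :: nat \<Rightarrow> 'a::real_normed_vector.
           (\<forall>n. u n \<in> S) \<longrightarrow> (\<lambda>n. I (u n)) \<longlonglongrightarrow> I m \<longrightarrow> u \<longlonglongrightarrow> m))"
proof -
  have "(INF x\<in>S. I x) = I m" if "m \<in> S" "\<forall>x\<in>S. I m \<le> I x" for m
    using that by (intro cInf_eq_minimum) auto
  then show ?thesis
    unfolding tykhonov_well_posed_def
    by (intro bex_cong refl conj_cong all_cong imp_cong) simp_all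
qed

text \<open>Instead of computing the derivative of the conjugate \<open>F\<close>, the proof compares the Ekeland point \<open>y\<close>
  with \<open>y + t *\<^sub>R k\<close> for small \<open>t > 0\<close>, where \<open>k\<close> norms \<open>x - M y\<close>. The minimizers \<open>w t\<close> of the problems
  perturbed by \<open>y + t *\<^sub>R k\<close> form a minimizing sequence for the problem perturbed by \<open>y\<close> as \<open>t\<close>
  tends to \<open>0\<close>, hence converge to \<open>M y\<close>.\<close>

theorem convex_if_linear_perturbations_well_posed:
  fixes I :: "'a::real_normed_vector \<Rightarrow> real"
  assumes S: "closed S"
    and twp: "\<And>y :: 'a \<Rightarrow>\<^sub>L real. tykhonov_well_posed (\<lambda>x. I x - y x) S"
  shows "convex S"
proof (rule convexI)
  fix a b and \<alpha> \<beta> :: real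
  assume ab: "a \<in> S" "b \<in> S" and conv: "0 \<le> \<alpha>" "0 \<le> \<beta>" "\<alpha> + \<beta> = 1"
  define x where "x = \<alpha> *\<^sub>R a + \<beta> *\<^sub>R b"
  have "\<forall>y :: 'a \<Rightarrow>\<^sub>L real. \<exists>m. m \<in> S \<and> (\<forall>s\<in>S. I m - y m \<le> I s - y s) \<and>
     (\<forall>u. (\<forall>n. u n \<in> S) \<longrightarrow> (\<lambda>n. I (u n) - y (u n)) \<longlonglongrightarrow> I m - y m \<longrightarrow> u \<longlonglongrightarrow> m)"
    using twp unfolding tykhonov_well_posed_iff_min_value by blast
  from choice[OF this] obtain M :: "('a \<Rightarrow>\<^sub>L real) \<Rightarrow> 'a" where M:
    "\<forall>y. M y \<in> S \<and> (\<forall>s\<in>S. I (M y) - blinfun_apply y (M y) \<le> I s - blinfun_apply y s) \<and>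
       (\<forall>u. (\<forall>n. u n \<in> S) \<longrightarrow>
          (\<lambda>n. I (u n) - blinfun_apply y (u n)) \<longlonglongrightarrow> I (M y) - blinfun_apply y (M y) \<longrightarrow>
          u \<longlonglongrightarrow> M y)"
    by (rule exE)
  have MS: "M y \<in> S" for y using M by blast
  have M_min: "I (M y) - blinfun_apply y (M y) \<le> I s - blinfun_apply y s" if "s \<in> S" for y s
    using M that by blast
  have M_strong: "u \<longlonglongrightarrow> M y" if "\<And>n. u n \<in> S"
    "(\<lambda>n. I (u n) - blinfun_apply y (u n)) \<longlonglongrightarrow> I (M y) - blinfun_apply y (M y)" for y u
    using M that by blast
  define F where "F y = blinfun_apply y (M y) - I (M y)" for y :: "'a \<Rightarrow>\<^sub>L real"
  have F_ge: "y s - I s \<le> F y" if "s \<in> S" for y :: "'a \<Rightarrow>\<^sub>L real" and s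
    using M_min[OF that, of y] by (simp add: F_def)
  have bdd: "- (\<alpha> * I a + \<beta> * I b) \<le> F y - y x" for y
  proof -
    have "\<alpha> * (y a - I a) + \<beta> * (y b - I b) \<le> \<alpha> * F y + \<beta> * F y"
      using F_ge ab conv by (intro add_mono mult_left_mono) auto
    also have "\<dots> = F y" using conv by (simp flip: distrib_right)
    finally show ?thesis
      by (simp add: x_def blinfun.add_right blinfun.scaleR_right algebra_simps)
  qed
  have lsc: "closed {y. F y - y x \<le> c}" for c
  proof -
    have "F y - y x \<le> c \<longleftrightarrow> (\<forall>s\<in>S. y s - I s - y x \<le> c)" for y
      using F_ge[of _ y] MS[of y] by (force simp: F_def)
    then have "{y. F y - y x \<le> c} = (\<Inter>s\<in>S. {y. blinfun_apply y s - I s - y x \<le> c})" by auto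
    also have "closed \<dots>"
      by (intro closed_INT ballI closed_Collect_le continuous_intros)
    finally show ?thesis .
  qed
  have approx: "\<exists>s\<in>S. dist s x \<le> \<epsilon>" if eps: "0 < \<epsilon>" for \<epsilon>
  proof -
    obtain y where y: "\<And>z. z \<noteq> y \<Longrightarrow> F y - y x < (F z - z x) + \<epsilon> * dist y z"
      using ekeland_variational_principle[OF eps bdd lsc] by blast
    obtain k :: "'a \<Rightarrow>\<^sub>L real" where k: "\<And>v. \<bar>k v\<bar> \<le> 1 * norm v"
        "norm (x - M y) \<le> k (x - M y)"
      using mazur_orlicz_norm[of 1 "{x - M y}" "\<lambda>_. norm (x - M y)"]
      by (auto simp: concave_on_const)
    have norm_k: "norm k \<le> 1" using k(1) by (intro norm_blinfun_bound) auto
    \<comment> \<open>\<open>w t\<close> is the minimizer after a step of length \<open>t\<close> in direction \<open>k\<close>\<close>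
    define w where "w t = M (y + t *\<^sub>R k)" for t
    have w_min: "I (w t) - y (w t) - t * k (w t) \<le> I s - y s - t * k s" if "s \<in> S" for s t
      using M_min[OF that, of "y + t *\<^sub>R k"] unfolding w_def
      by (simp add: blinfun.add_left blinfun.scaleR_left algebra_simps)
    have wS: "w t \<in> S" for t by (simp add: w_def MS)
    \<comment> \<open>monotonicity of the derivative of a convex function; it bounds \<open>k (w t)\<close> for \<open>t < 1\<close>\<close>
    have mono: "k (w s) \<le> k (w t)" if "s < t" for s t
    proof -
      have "(t - s) * k (w s) \<le> (t - s) * k (w t)"
        using w_min[OF wS[of s], of t] w_min[OF wS[of t], of s] by (simp add: algebra_simps)
      then show ?thesis using that by simp
    qed
    define \<tau> :: "nat \<Rightarrow> real" where "\<tau> n = inverse (real (n + 2))" for n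
    have tau: "0 < \<tau> n" "\<tau> n < 1" for n by (auto simp: \<tau>_def field_simps)
    have tau0: "\<tau> \<longlonglongrightarrow> 0" unfolding \<tau>_def by real_asymp
    have "(\<lambda>n. w (\<tau> n)) \<longlonglongrightarrow> M y"
    proof (rule M_strong)
      show "w (\<tau> n) \<in> S" for n by (rule wS)
      show "(\<lambda>n. I (w (\<tau> n)) - y (w (\<tau> n))) \<longlonglongrightarrow> I (M y) - y (M y)"
      proof (rule tendsto_sandwich)
        show "\<forall>\<^sub>F n in sequentially. I (M y) - y (M y) \<le> I (w (\<tau> n)) - y (w (\<tau> n))"
          using M_min wS by simp
        show "\<forall>\<^sub>F n in sequentially. I (w (\<tau> n)) - y (w (\<tau> n)) \<le>
            I (M y) - y (M y) + \<tau> n * (k (w 1) - k (M y))"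
        proof (intro always_eventually allI)
          fix n
          have "\<tau> n * k (w (\<tau> n)) \<le> \<tau> n * k (w 1)"
            using mono[OF tau(2)[of n]] tau(1)[of n] by simp
          then show "I (w (\<tau> n)) - y (w (\<tau> n)) \<le>
              I (M y) - y (M y) + \<tau> n * (k (w 1) - k (M y))"
            using w_min[OF MS[of y], of "\<tau> n"] by (simp add: right_diff_distrib)
        qed
        have "(\<lambda>n. I (M y) - y (M y) + \<tau> n * (k (w 1) - k (M y))) \<longlonglongrightarrow>
            I (M y) - y (M y) + 0 * (k (w 1) - k (M y))"
          by (intro tendsto_intros tau0)
        then show "(\<lambda>n. I (M y) - y (M y) + \<tau> n * (k (w 1) - k (M y))) \<longlonglongrightarrow>
            I (M y) - y (M y)"
          by simp
      qed simp
    qed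
    then have lim: "(\<lambda>n. k (w (\<tau> n))) \<longlonglongrightarrow> k (M y)" by (intro tendsto_intros)
    have "k x - \<epsilon> \<le> k (w t)" if t: "0 < t" for t
    proof (cases "k = 0")
      \<comment> \<open>the strict Ekeland inequality is unavailable at \<open>y\<close> itself, but here the claim is trivial\<close>
      case True
      then show ?thesis using eps by simp
    next
      case False
      have "\<epsilon> * dist y (y + t *\<^sub>R k) \<le> \<epsilon> * t"
        using eps t norm_k by (simp add: dist_norm mult_left_le)
      moreover have "F y - y x < (F (y + t *\<^sub>R k) - (y + t *\<^sub>R k) x) + \<epsilon> * dist y (y + t *\<^sub>R k)"
        using False t by (intro y) simp
      moreover have "F (y + t *\<^sub>R k) = y (w t) + t * k (w t) - I (w t)"
        by (simp add: F_def w_def blinfun.add_left blinfun.scaleR_left)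
      ultimately have "t * (k x - \<epsilon>) \<le> t * k (w t)"
        using F_ge[OF wS[of t], of y]
        by (simp add: blinfun.add_left blinfun.scaleR_left algebra_simps)
      then show ?thesis using t by simp
    qed
    then have "k x - \<epsilon> \<le> k (M y)" using tau by (intro LIMSEQ_le_const[OF lim]) auto
    then have "dist (M y) x \<le> \<epsilon>"
      using k(2) by (simp add: blinfun.diff_right dist_norm norm_minus_commute)
    then show ?thesis using MS by blast
  qed
  have "\<exists>s\<in>S. dist s x < e" if "0 < e" for e
    using approx[of "e / 2"] that by force
  then have "x \<in> closure S" by (simp add: closure_approachable)
  then show "\<alpha> *\<^sub>R a + \<beta> *\<^sub>R b \<in> S" using S by (simp add: x_def)
qed

section \<open>Minimizing sequences in E-spaces\<close>

lemma rotund_midpoint_norm_square: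
  fixes a b :: "'a::real_normed_vector"
  assumes rot: "rotund TYPE('a)" and ne: "a \<noteq> b"
  shows "(norm ((1/2) *\<^sub>R (a + b)))\<^sup>2 < ((norm a)\<^sup>2 + (norm b)\<^sup>2) / 2"
proof (cases "norm a = norm b")
  case False
  have "norm ((1/2) *\<^sub>R (a + b)) \<le> (norm a + norm b) / 2"
    using norm_triangle_ineq[of a b] by simp
  then have "(norm ((1/2) *\<^sub>R (a + b)))\<^sup>2 \<le> ((norm a + norm b) / 2)\<^sup>2"
    by (intro power_mono) auto
  moreover have "0 < (norm a - norm b)\<^sup>2" using False by simp
  ultimately show ?thesis by (simp add: power2_eq_square field_simps)
next
  case True
  define r where "r = norm a"
  have r: "0 < r" "norm b = r" using True ne by (auto simp: r_def)
  define v where "v = (1/2) *\<^sub>R (a + b)"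
  have "norm ((1/2) *\<^sub>R ((1/r) *\<^sub>R a + (1/r) *\<^sub>R b)) < 1"
    using rot r ne unfolding rotund_def by (auto simp: r_def)
  also have "(1/2) *\<^sub>R ((1/r) *\<^sub>R a + (1/r) *\<^sub>R b) = (1/r) *\<^sub>R v"
    by (simp add: v_def scaleR_add_right mult.commute)
  finally have "norm ((1/2) *\<^sub>R (a + b)) < r"
    using r unfolding v_def[symmetric] by simp
  then have "(norm ((1/2) *\<^sub>R (a + b)))\<^sup>2 < r\<^sup>2" by (intro power_strict_mono) auto
  then show ?thesis using r by (simp add: r_def)
qed

lemma closedin_weak_hyperplane:
  fixes z :: "'a::real_normed_vector \<Rightarrow>\<^sub>L real"
  shows "closedin weak_topology {v. z v = c}"
proof -
  have "openin weak_topology (blinfun_apply z -` (- {c}))"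
    unfolding weak_topology_def
    by (rule topology_generated_by_Basis) (auto intro!: exI[of _ z] exI[of _ "- {c}"])
  moreover have "blinfun_apply z -` (- {c}) = UNIV - {v. z v = c}" by auto
  ultimately show ?thesis by (simp add: closedin_def topspace_weak_topology)
qed

text \<open>Points on which \<open>z\<close> is almost maximal relative to the norm become, after rescaling, a sequence in
  the hyperplane \<open>{v. z v = r\<^sup>2}\<close> that minimizes the distance to \<open>0\<close>, which is \<open>r\<close>.\<close>

lemma E_space_norming_sequence_subconverges:
  fixes z :: "'a::banach \<Rightarrow>\<^sub>L real" and u :: "nat \<Rightarrow> 'a"
  assumes E: "E_space TYPE('a)" and r: "0 < r" and z: "\<And>v. \<bar>z v\<bar> \<le> r * norm v"
    and nu: "(\<lambda>n. norm (u n)) \<longlonglongrightarrow> r" and zu: "(\<lambda>n. z (u n)) \<longlonglongrightarrow> r\<^sup>2"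
  obtains \<rho> l where "strict_mono \<rho>" "(u \<circ> \<rho>) \<longlonglongrightarrow> l"
proof -
  have "\<forall>\<^sub>F n in sequentially. 0 < z (u n)" by (rule order_tendstoD[OF zu]) (use r in simp)
  then obtain N where N: "\<And>n. N \<le> n \<Longrightarrow> 0 < z (u n)" by (auto simp: eventually_sequentially)
  \<comment> \<open>dropping finitely many terms makes the rescaling by \<open>z (w n)\<close> possible\<close>
  define w where "w n = u (n + N)" for n
  have nw: "(\<lambda>n. norm (w n)) \<longlonglongrightarrow> r" and zw: "(\<lambda>n. z (w n)) \<longlonglongrightarrow> r\<^sup>2"
    unfolding w_def using LIMSEQ_ignore_initial_segment[OF nu, of N]
      LIMSEQ_ignore_initial_segment[OF zu, of N] by simp_all
  have pos: "0 < z (w n)" for n using N by (simp add: w_def)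
  define A where "A = {v. z v = r\<^sup>2}"
  define v where "v n = (r\<^sup>2 / z (w n)) *\<^sub>R w n" for n
  have vA: "v n \<in> A" for n using pos[of n] by (simp add: A_def v_def blinfun.scaleR_right)
  then have "A \<noteq> {}" by blast
  then have ac: "approximately_compact A"
    using E closedin_weak_hyperplane[of z "r\<^sup>2"] by (simp add: E_space_def A_def)
  have "(\<lambda>n. \<bar>r\<^sup>2 / z (w n)\<bar> * norm (w n)) \<longlonglongrightarrow> \<bar>r\<^sup>2 / r\<^sup>2\<bar> * r"
    by (intro tendsto_intros nw zw) (use r in simp)
  then have nv: "(\<lambda>n. norm (v n)) \<longlonglongrightarrow> r" using r by (simp add: v_def)
  have low: "r \<le> norm y" if "y \<in> A" for y
  proof -
    have "r * r \<le> r * norm y" using z[of y] that by (simp add: A_def power2_eq_square)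
    then show ?thesis using r by simp
  qed
  have "(INF y\<in>A. norm (0 - y)) = r"
  proof (rule antisym)
    have "(INF y\<in>A. norm (0 - y)) \<le> norm (v n)" for n
      using vA[of n] by (intro cINF_lower2[of _ _ "v n"] bdd_belowI2[of _ 0]) auto
    then show "(INF y\<in>A. norm (0 - y)) \<le> r" by (intro LIMSEQ_le_const[OF nv]) auto
    show "r \<le> (INF y\<in>A. norm (0 - y))" using \<open>A \<noteq> {}\<close> low by (intro cINF_greatest) auto
  qed
  then have "(\<lambda>n. norm (0 - v n)) \<longlonglongrightarrow> (INF y\<in>A. norm (0 - y))" using nv by simp
  then obtain \<sigma> l where sl: "strict_mono \<sigma>" "(v \<circ> \<sigma>) \<longlonglongrightarrow> l"
    using ac vA unfolding approximately_compact_def by metis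
  have "(\<lambda>n. (z (w (\<sigma> n)) / r\<^sup>2) *\<^sub>R v (\<sigma> n)) \<longlonglongrightarrow> (r\<^sup>2 / r\<^sup>2) *\<^sub>R l"
    using sl LIMSEQ_subseq_LIMSEQ[OF zw sl(1)] r by (intro tendsto_intros) (auto simp: o_def)
  moreover have "(z (w (\<sigma> n)) / r\<^sup>2) *\<^sub>R v (\<sigma> n) = u (\<sigma> n + N)" for n
    using pos[of "\<sigma> n"] r by (simp add: v_def w_def)
  ultimately have "(u \<circ> (\<lambda>n. \<sigma> n + N)) \<longlonglongrightarrow> l" using r by (simp add: o_def)
  moreover have "strict_mono (\<lambda>n. \<sigma> n + N)" using sl(1) by (simp add: strict_mono_def)
  ultimately show ?thesis by (rule that[rotated])
qed

text \<open>The first order condition at a minimum that need not be attained: compare \<open>u n\<close> with a point on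
  the segment to \<open>s\<close>, let \<open>n\<close> tend to infinity, divide by the step length \<open>t\<close> and let \<open>t\<close> tend to \<open>0\<close>.
  In the limit the square becomes the sublinear functional \<open>r * norm s\<close>, to which the Mazur--Orlicz
  theorem applies.\<close>

lemma half_square_variational_inequality:
  fixes S :: "'a::real_normed_vector set" and f :: "'a \<Rightarrow>\<^sub>L real"
  assumes S: "convex S" and u: "\<And>n. u n \<in> S"
    and nu: "(\<lambda>n. norm (u n)) \<longlonglongrightarrow> r" and fu: "(\<lambda>n. f (u n)) \<longlonglongrightarrow> \<alpha>"
    and min: "\<And>s. s \<in> S \<Longrightarrow> (1/2) * r\<^sup>2 - \<alpha> \<le> (1/2) * (norm s)\<^sup>2 - f s"
    and s: "s \<in> S"
  shows "r\<^sup>2 - \<alpha> \<le> r * norm s - f s"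
proof -
  define D where "D = norm s - r"
  have t: "0 \<le> r * D + \<alpha> - f s + t * (D\<^sup>2 / 2)" if t: "0 < t" "t < 1" for t
  proof -
    have "(1/2) * r\<^sup>2 - \<alpha> \<le>
        (1/2) * ((1 - t) * norm (u n) + t * norm s)\<^sup>2 - ((1 - t) * f (u n) + t * f s)" for n
    proof -
      have "(1 - t) *\<^sub>R u n + t *\<^sub>R s \<in> S" using S u s t by (intro convexD) auto
      then have "(1/2) * r\<^sup>2 - \<alpha> \<le> (1/2) * (norm ((1 - t) *\<^sub>R u n + t *\<^sub>R s))\<^sup>2
          - ((1 - t) * f (u n) + t * f s)"
        using min[of "(1 - t) *\<^sub>R u n + t *\<^sub>R s"] by (simp add: blinfun.add_right blinfun.scaleR_right)
      moreover have "norm ((1 - t) *\<^sub>R u n + t *\<^sub>R s) \<le> (1 - t) * norm (u n) + t * norm s"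
        using norm_triangle_ineq[of "(1 - t) *\<^sub>R u n" "t *\<^sub>R s"] t by simp
      then have "(norm ((1 - t) *\<^sub>R u n + t *\<^sub>R s))\<^sup>2 \<le> ((1 - t) * norm (u n) + t * norm s)\<^sup>2"
        by (intro power_mono) auto
      ultimately show ?thesis by simp
    qed
    moreover have "(\<lambda>n. (1/2) * ((1 - t) * norm (u n) + t * norm s)\<^sup>2
          - ((1 - t) * f (u n) + t * f s)) \<longlonglongrightarrow>
        (1/2) * ((1 - t) * r + t * norm s)\<^sup>2 - ((1 - t) * \<alpha> + t * f s)"
      by (intro tendsto_intros nu fu)
    ultimately have "(1/2) * r\<^sup>2 - \<alpha> \<le>
        (1/2) * ((1 - t) * r + t * norm s)\<^sup>2 - ((1 - t) * \<alpha> + t * f s)"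
      by (intro LIMSEQ_le_const) auto
    also have "\<dots> = (1/2) * r\<^sup>2 - \<alpha> + t * (r * D + \<alpha> - f s + t * (D\<^sup>2 / 2))"
      by (simp add: D_def power2_eq_square field_simps)
    finally show ?thesis using t by (simp add: zero_le_mult_iff)
  qed
  define \<tau> :: "nat \<Rightarrow> real" where "\<tau> n = inverse (real (n + 2))" for n
  have tau: "0 < \<tau> n" "\<tau> n < 1" for n by (auto simp: \<tau>_def field_simps)
  have tau0: "\<tau> \<longlonglongrightarrow> 0" unfolding \<tau>_def by real_asymp
  have "(\<lambda>n. r * D + \<alpha> - f s + \<tau> n * (D\<^sup>2 / 2)) \<longlonglongrightarrow> r * D + \<alpha> - f s + 0 * (D\<^sup>2 / 2)"
    by (intro tendsto_intros tau0)
  then have "0 \<le> r * D + \<alpha> - f s + 0 * (D\<^sup>2 / 2)"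
    using t tau by (intro LIMSEQ_le_const) auto
  then show ?thesis by (simp add: D_def power2_eq_square algebra_simps)
qed

text \<open>Coercivity: the infimum is finite, and minimizing sequences are bounded.\<close>

lemma half_square_minus_linear_ge:
  fixes f :: "'a::real_normed_vector \<Rightarrow>\<^sub>L real"
  shows "- ((norm f)\<^sup>2 / 2) \<le> (1/2) * (norm x)\<^sup>2 - f x"
    and "norm x \<le> 2 * norm f + 1 + 2 * \<bar>(1/2) * (norm x)\<^sup>2 - f x\<bar>"
proof -
  have le: "f x \<le> norm f * norm x" using norm_blinfun[of f x] by simp
  show "- ((norm f)\<^sup>2 / 2) \<le> (1/2) * (norm x)\<^sup>2 - f x"
    using zero_le_power2[of "norm x - norm f"] le by (simp add: power2_diff algebra_simps)
  show "norm x \<le> 2 * norm f + 1 + 2 * \<bar>(1/2) * (norm x)\<^sup>2 - f x\<bar>"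
  proof (rule ccontr)
    define B where "B = \<bar>(1/2) * (norm x)\<^sup>2 - f x\<bar>"
    assume "\<not> ?thesis"
    then have big: "2 * norm f + (1 + 2 * B) < norm x" by (simp add: B_def)
    have B: "0 \<le> B" by (simp add: B_def)
    have n1: "1 \<le> norm x" using big B norm_ge_zero[of f] by linarith
    have "(2 * norm f + (1 + 2 * B)) * norm x \<le> norm x * norm x"
      using big by (intro mult_right_mono) auto
    moreover have "(1 + 2 * B) * 1 \<le> (1 + 2 * B) * norm x"
      using n1 B by (intro mult_left_mono) auto
    ultimately have "2 * (norm f * norm x) + (1 + 2 * B) \<le> (norm x)\<^sup>2"
      by (simp add: power2_eq_square algebra_simps)
    moreover have "(1/2) * (norm x)\<^sup>2 - f x \<le> B" by (simp add: B_def)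
    ultimately show False using le by simp
  qed
qed

text \<open>The variational inequality says that the affine function \<open>f s + \<beta>\<close> lies below \<open>r * norm s\<close> on
  \<open>S\<close>. A linear functional \<open>z\<close> in between is squeezed to \<open>r\<^sup>2\<close> along the sequence, because both
  bounds tend to \<open>r\<^sup>2\<close> there.\<close>

lemma minimizing_sequence_subconverges:
  fixes S :: "'a::banach set" and f :: "'a \<Rightarrow>\<^sub>L real"
  assumes E: "E_space TYPE('a)" and S: "convex S" and u: "\<And>n. u n \<in> S"
    and m: "\<And>s. s \<in> S \<Longrightarrow> m \<le> (1/2) * (norm s)\<^sup>2 - f s"
    and lim: "(\<lambda>n. (1/2) * (norm (u n))\<^sup>2 - f (u n)) \<longlonglongrightarrow> m"
  obtains \<rho> l where "strict_mono \<rho>" "(u \<circ> \<rho>) \<longlonglongrightarrow> l"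
proof -
  obtain K where K: "\<And>n. \<bar>(1/2) * (norm (u n))\<^sup>2 - f (u n)\<bar> \<le> K"
    using convergent_imp_Bseq[OF convergentI[OF lim]] by (auto simp: Bseq_def)
  have "norm (u n) \<le> 2 * norm f + 1 + 2 * K" for n
    by (rule order_trans[OF half_square_minus_linear_ge(2)[of "u n" f]]) (use K[of n] in simp)
  then have "bounded (range (\<lambda>n. norm (u n)))" by (auto simp: bounded_iff)
  then obtain r \<sigma> where sg: "strict_mono \<sigma>" and r: "((\<lambda>n. norm (u n)) \<circ> \<sigma>) \<longlonglongrightarrow> r"
    using bounded_imp_convergent_subsequence by blast
  define w where "w = u \<circ> \<sigma>"
  have wS: "w n \<in> S" for n using u by (simp add: w_def)
  have nw: "(\<lambda>n. norm (w n)) \<longlonglongrightarrow> r" using r by (simp add: w_def o_def)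
  have r0: "0 \<le> r" using nw by (rule LIMSEQ_le_const) auto
  have "(\<lambda>n. (1/2) * (norm (w n))\<^sup>2 - f (w n)) \<longlonglongrightarrow> m"
    using LIMSEQ_subseq_LIMSEQ[OF lim sg] by (simp add: w_def o_def)
  then have "(\<lambda>n. (1/2) * (norm (w n))\<^sup>2 - ((1/2) * (norm (w n))\<^sup>2 - f (w n))) \<longlonglongrightarrow> (1/2) * r\<^sup>2 - m"
    by (intro tendsto_intros nw)
  then have fw: "(\<lambda>n. f (w n)) \<longlonglongrightarrow> (1/2) * r\<^sup>2 - m" by simp
  \<comment> \<open>\<open>\<beta> = r\<^sup>2 - lim f (w n)\<close>\<close>
  define \<beta> where "\<beta> = (1/2) * r\<^sup>2 + m"
  have "\<exists>\<rho> l. strict_mono \<rho> \<and> (w \<circ> \<rho>) \<longlonglongrightarrow> l"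
  proof (cases "r = 0")
    case True
    then have "w \<longlonglongrightarrow> 0" using nw tendsto_norm_zero_iff by auto
    then show ?thesis by (intro exI[of _ id] exI[of _ 0]) (auto simp: strict_mono_def)
  next
    case False
    have "f s + \<beta> \<le> r * norm s" if "s \<in> S" for s
      using half_square_variational_inequality[OF S wS nw fw _ that] m by (simp add: \<beta>_def)
    moreover have "concave_on S (\<lambda>s. f s + \<beta>)"
      using S by (auto simp: concave_on_iff blinfun.add_right blinfun.scaleR_right algebra_simps
          simp flip: distrib_right)
    ultimately obtain z :: "'a \<Rightarrow>\<^sub>L real" where z: "\<And>v. \<bar>z v\<bar> \<le> r * norm v"
        "\<And>s. s \<in> S \<Longrightarrow> f s + \<beta> \<le> z s"
      using mazur_orlicz_norm[OF r0, of S "\<lambda>s. f s + \<beta>"] wS by blast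
    have "(\<lambda>n. z (w n)) \<longlonglongrightarrow> r\<^sup>2"
    proof (rule tendsto_sandwich)
      show "\<forall>\<^sub>F n in sequentially. f (w n) + \<beta> \<le> z (w n)" using z(2) wS by simp
      show "\<forall>\<^sub>F n in sequentially. z (w n) \<le> r * norm (w n)"
        using z(1) by (simp add: abs_le_iff)
      show "(\<lambda>n. f (w n) + \<beta>) \<longlonglongrightarrow> r\<^sup>2"
        using tendsto_add[OF fw tendsto_const[of \<beta>]] by (simp add: \<beta>_def)
      show "(\<lambda>n. r * norm (w n)) \<longlonglongrightarrow> r\<^sup>2"
        using tendsto_mult[OF tendsto_const[of r] nw] by (simp add: power2_eq_square)
    qed
    then show ?thesis
      using E_space_norming_sequence_subconverges[OF E _ z(1) nw] r0 False by (metis less_eq_real_def)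
  qed
  then obtain \<rho> l where rl: "strict_mono \<rho>" "(w \<circ> \<rho>) \<longlonglongrightarrow> l" by blast
  show ?thesis
    using that[OF strict_mono_o[OF sg rl(1)]] rl(2) by (simp add: w_def o_assoc)
qed

lemma LIMSEQ_if_subsequences_subconverge:
  fixes u :: "nat \<Rightarrow> 'a::metric_space"
  assumes "\<And>\<sigma> :: nat \<Rightarrow> nat. strict_mono \<sigma> \<Longrightarrow> \<exists>\<rho> :: nat \<Rightarrow> nat. strict_mono \<rho> \<and> (u \<circ> \<sigma> \<circ> \<rho>) \<longlonglongrightarrow> l"
  shows "u \<longlonglongrightarrow> l"
proof (rule ccontr)
  assume "\<not> u \<longlonglongrightarrow> l"
  then obtain e where e: "0 < e" "\<not> (\<forall>\<^sub>F n in sequentially. dist (u n) l < e)"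
    unfolding tendsto_iff by blast
  then have "infinite {n. e \<le> dist (u n) l}"
    unfolding eventually_sequentially infinite_nat_iff_unbounded_le by (auto simp: not_less)
  from infinite_enumerate[OF this] obtain \<sigma> :: "nat \<Rightarrow> nat"
    where s: "strict_mono \<sigma>" "\<And>n. e \<le> dist (u (\<sigma> n)) l"
    by blast
  then obtain \<rho> where "(u \<circ> \<sigma> \<circ> \<rho>) \<longlonglongrightarrow> l" using assms[OF s(1)] by blast
  then have "\<forall>\<^sub>F n in sequentially. dist ((u \<circ> \<sigma> \<circ> \<rho>) n) l < e"
    using e(1) by (rule tendstoD)
  then obtain n where "dist (u (\<sigma> (\<rho> n))) l < e"
    by (auto simp: eventually_sequentially)
  then show False using s(2)[of "\<rho> n"] by simp
qed

theorem E_space_half_square_minus_linear_well_posed: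
  fixes S :: "'a::banach set" and f :: "'a \<Rightarrow>\<^sub>L real"
  assumes E: "E_space TYPE('a)" and ne: "S \<noteq> {}" and cl: "closed S" and S: "convex S"
  shows "tykhonov_well_posed (\<lambda>x. (1/2) * (norm x)\<^sup>2 - f x) S"
proof -
  define J where "J x = (1/2) * (norm x)\<^sup>2 - f x" for x
  define m where "m = (INF x\<in>S. J x)"
  have bdd: "bdd_below (J ` S)"
    by (rule bdd_belowI2) (unfold J_def, rule half_square_minus_linear_ge(1))
  have m: "m \<le> J s" if "s \<in> S" for s
    unfolding m_def using bdd that by (rule cINF_lower)
  have sub: "\<exists>\<rho> l. strict_mono \<rho> \<and> l \<in> S \<and> J l = m \<and> (u \<circ> \<rho>) \<longlonglongrightarrow> l"
    if u: "\<And>n. u n \<in> S" and lim: "(\<lambda>n. J (u n)) \<longlonglongrightarrow> m" for u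
  proof -
    obtain \<rho> l where rl: "strict_mono \<rho>" "(u \<circ> \<rho>) \<longlonglongrightarrow> l"
      using minimizing_sequence_subconverges[OF E S u m[unfolded J_def] lim[unfolded J_def]] by metis
    have "l \<in> S" using closed_sequentially[OF cl _ rl(2)] u by simp
    have "(\<lambda>n. J ((u \<circ> \<rho>) n)) \<longlonglongrightarrow> J l" unfolding J_def by (intro tendsto_intros rl)
    moreover have "(\<lambda>n. J ((u \<circ> \<rho>) n)) \<longlonglongrightarrow> m"
      using LIMSEQ_subseq_LIMSEQ[OF lim rl(1)] by (simp add: o_def)
    ultimately have "J l = m" by (rule LIMSEQ_unique)
    then show ?thesis using rl \<open>l \<in> S\<close> by blast
  qed
  have uniq: "a = b" if ab: "a \<in> S" "b \<in> S" "J a = m" "J b = m" for a b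
  proof (rule ccontr)
    assume "a \<noteq> b"
    then have "(norm ((1/2) *\<^sub>R (a + b)))\<^sup>2 < ((norm a)\<^sup>2 + (norm b)\<^sup>2) / 2"
      using E by (intro rotund_midpoint_norm_square) (auto simp: E_space_def)
    then have "J ((1/2) *\<^sub>R (a + b)) < (J a + J b) / 2"
      by (simp add: J_def blinfun.add_right blinfun.scaleR_right field_simps)
    moreover have "(1/2) *\<^sub>R (a + b) \<in> S"
      using convexD[OF S ab(1,2), of "1/2" "1/2"] by (simp add: scaleR_add_right)
    ultimately show False using m[of "(1/2) *\<^sub>R (a + b)"] ab by simp
  qed
  have "\<exists>s\<in>S. J s < m + 1 / real (Suc n)" for n
    using cInf_lessD[of "J ` S" "m + 1 / real (Suc n)"] ne by (auto simp: m_def)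
  then obtain u where u: "\<And>n. u n \<in> S" "\<And>n. J (u n) < m + 1 / real (Suc n)" by metis
  have "(\<lambda>n. J (u n)) \<longlonglongrightarrow> m"
  proof (rule tendsto_sandwich)
    show "\<forall>\<^sub>F n in sequentially. m \<le> J (u n)" using m u by simp
    show "\<forall>\<^sub>F n in sequentially. J (u n) \<le> m + 1 / real (Suc n)"
      using u(2) by (simp add: less_imp_le)
    show "(\<lambda>n. m + 1 / real (Suc n)) \<longlonglongrightarrow> m" by real_asymp
  qed simp
  then obtain xbar where xbar: "xbar \<in> S" "J xbar = m" using sub[of u] u by blast
  have "tykhonov_well_posed J S"
    unfolding tykhonov_well_posed_iff_min_value
  proof (intro bexI[OF _ xbar(1)] conjI ballI allI impI)
    show "J xbar \<le> J x" if "x \<in> S" for x using m that xbar by simp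
    fix u :: "nat \<Rightarrow> 'a" assume u: "\<forall>n. u n \<in> S" "(\<lambda>n. J (u n)) \<longlonglongrightarrow> J xbar"
    show "u \<longlonglongrightarrow> xbar"
    proof (rule LIMSEQ_if_subsequences_subconverge)
      fix \<sigma> :: "nat \<Rightarrow> nat" assume "strict_mono \<sigma>"
      then have "(\<lambda>n. J ((u \<circ> \<sigma>) n)) \<longlonglongrightarrow> m"
        using LIMSEQ_subseq_LIMSEQ[OF u(2)] xbar by (simp add: o_def)
      then show "\<exists>\<rho>. strict_mono \<rho> \<and> (u \<circ> \<sigma> \<circ> \<rho>) \<longlonglongrightarrow> xbar"
        using sub[of "u \<circ> \<sigma>"] u(1) uniq xbar by (metis comp_apply)
    qed
  qed
  then show ?thesis by (simp add: J_def[abs_def])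
qed

theorem proposition10:
  fixes S :: "'a::banach set"
  assumes "S \<noteq> {}" and "closed S"
  shows "((\<forall>xs :: 'a \<Rightarrow>\<^sub>L real.
             tykhonov_well_posed (\<lambda>x. (1/2) * (norm x)\<^sup>2 - blinfun_apply xs x) S)
           \<longrightarrow> convex S)
       \<and> (E_space TYPE('a) \<longrightarrow> convex S \<longrightarrow>
           (\<forall>xs :: 'a \<Rightarrow>\<^sub>L real.
             tykhonov_well_posed (\<lambda>x. (1/2) * (norm x)\<^sup>2 - blinfun_apply xs x) S))"
proof (intro conjI impI allI)
  assume "\<forall>xs :: 'a \<Rightarrow>\<^sub>L real.
      tykhonov_well_posed (\<lambda>x. (1/2) * (norm x)\<^sup>2 - blinfun_apply xs x) S"
  then show "convex S"
    by (intro convex_if_linear_perturbations_well_posed[OF assms(2)]) (rule spec)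
next
  fix xs :: "'a \<Rightarrow>\<^sub>L real"
  assume "E_space TYPE('a)" "convex S"
  then show "tykhonov_well_posed (\<lambda>x. (1/2) * (norm x)\<^sup>2 - blinfun_apply xs x) S"
    using assms by (intro E_space_half_square_minus_linear_well_posed)
qed

end
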